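(* Let $n,k,f\ge1$ be integers, and assume the Erdős Girth Conjecture. Then there exists a simple graph $G$ with $n$ vertices and colored edges such that every $f$-ECFT $(2k-1)$-spanner of $G$ has $\Omega(\min\{fn^{1+1/k},n^2\})$ edges.
   Context: Erdős Girth Conjecture: for all integers $n,k\ge1$ there is an $n$-vertex graph of girth at least $2k+2$ with $\Omega(n^{1+1/k})$ edges. Edge colors are arbitrary. For a set $F$ of colors, $G-F$ deletes all edges whose color lies in $F$. A subgraph $H$ (inheriting colors) is an $f$-ECFT $t$-spanner of $G$ if for every set $F$ of at most $f$ colors, $\operatorname{dist}_{H-F}(u,v)\le t\cdot\operatorname{dist}_{G-F}(u,v)$ for all vertices $u,v$. *)

theory Defs
  imports Complex_Main "HOL-Library.Extended_Nat"
begin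

type_synonym 'a graph = "'a set \<times> 'a set set"

abbreviation verts :: "'a graph \<Rightarrow> 'a set" where "verts \<equiv> fst"
abbreviation edges :: "'a graph \<Rightarrow> 'a set set" where "edges \<equiv> snd"

definition simple_graph :: "'a graph \<Rightarrow> bool" where
  "simple_graph G \<longleftrightarrow>
     finite (verts G) \<and> (\<forall>e\<in>edges G. \<exists>u\<in>verts G. \<exists>v\<in>verts G. u \<noteq> v \<and> e = {u, v})"

definition subgraph :: "'a graph \<Rightarrow> 'a graph \<Rightarrow> bool" where
  "subgraph H G \<longleftrightarrow> simple_graph H \<and> verts H \<subseteq> verts G \<and> edges H \<subseteq> edges G"

definition walk :: "'a graph \<Rightarrow> 'a list \<Rightarrow> bool" where
  "walk G p \<longleftrightarrow> p \<noteq> [] \<and> set p \<subseteq> verts G \<and>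
     (\<forall>i. Suc i < length p \<longrightarrow> {p ! i, p ! Suc i} \<in> edges G)"

text \<open>The infimum of the empty set in \<^typ>\<open>enat\<close> is infinity: vertices that are not
  connected have infinite distance, and forests have infinite girth.\<close>

definition gdist :: "'a graph \<Rightarrow> 'a \<Rightarrow> 'a \<Rightarrow> enat" where
  "gdist G u v = (INF p \<in> {p. walk G p \<and> hd p = u \<and> last p = v}. enat (length p - 1))"

definition cycle :: "'a graph \<Rightarrow> 'a list \<Rightarrow> bool" where
  "cycle G p \<longleftrightarrow> walk G p \<and> length p \<ge> 3 \<and> distinct p \<and> {last p, hd p} \<in> edges G"

definition girth :: "'a graph \<Rightarrow> enat" where
  "girth G = (INF p \<in> {p. cycle G p}. enat (length p))"

definition del_colors :: "'a graph \<Rightarrow> ('a set \<Rightarrow> 'c) \<Rightarrow> 'c set \<Rightarrow> 'a graph" where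
  "del_colors G col F = (verts G, {e \<in> edges G. col e \<notin> F})"

definition ecft_spanner ::
    "nat \<Rightarrow> nat \<Rightarrow> 'a graph \<Rightarrow> ('a set \<Rightarrow> 'c) \<Rightarrow> 'a graph \<Rightarrow> bool" where
  "ecft_spanner f t G col H \<longleftrightarrow> subgraph H G \<and>
     (\<forall>F. finite F \<and> card F \<le> f \<longrightarrow>
       (\<forall>u\<in>verts G. \<forall>v\<in>verts G.
          gdist (del_colors H col F) u v \<le> enat t * gdist (del_colors G col F) u v))"

text \<open>A graph on one vertex has no edges, so a lower bound with a positive constant can hold
  only from \<open>n = 2\<close> on.\<close>

definition girth_bound :: "real \<Rightarrow> nat \<Rightarrow> bool" where
  "girth_bound c k \<longleftrightarrow> (\<forall>n\<ge>2. \<exists>G :: nat graph.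
     simple_graph G \<and> card (verts G) = n \<and> girth G \<ge> enat (2 * k + 2) \<and>
     real (card (edges G)) \<ge> c * real n powr (1 + 1 / real k))"

text \<open>The two customary readings of the Erdos Girth Conjecture: the constant hidden in the
  asymptotic notation is absolute, or it may depend on \<open>k\<close>.\<close>

definition erdos_girth_conjecture :: bool where
  "erdos_girth_conjecture \<longleftrightarrow> (\<exists>c>0. \<forall>k\<ge>1. girth_bound c k)"

definition erdos_girth_conjecture_fixed_k :: bool where
  "erdos_girth_conjecture_fixed_k \<longleftrightarrow> (\<forall>k\<ge>1. \<exists>c>0. girth_bound c k)"

end

theory Submission
  imports Defs "HOL-Combinatorics.Permutations"
begin

text \<open>Overlay \<open>f\<close> relabelled copies of one graph of girth at least \<open>2 k + 2\<close> on a common vertex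
  set, and colour each edge by the first copy that contains it. After the failure of all colours
  other than that of an edge \<open>e\<close>, the graph has girth at least \<open>2 k + 2\<close>, so that a walk of length
  at most \<open>2 k - 1\<close> between the ends of \<open>e\<close> has to use \<open>e\<close>; hence a spanner contains every edge.
  The relabellings are chosen greedily: a uniformly random permutation of the vertices maps an edge
  to a uniformly distributed pair, so as long as at most half of all pairs are covered, some copy
  contributes at least half of its edges as new ones.\<close>

section \<open>Averaging over the permutations of a finite set\<close>

lemma ex_permutes_image_eq:
  assumes "finite V" "A \<subseteq> V" "B \<subseteq> V" "card A = card B"
  shows "\<exists>\<sigma>. \<sigma> permutes V \<and> \<sigma> ` A = B"
proof -
  have fin: "finite A" "finite B"
    using assms finite_subset by auto
  obtain g where g: "bij_betw g A B"
    using finite_same_card_bij[OF fin assms(4)] by blast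
  \<comment> \<open>The complements have equal size as well, so a bijection of \<open>A\<close> onto
    \<open>B\<close> can be glued to one between the complements and extended by the identity
    outside \<open>V\<close>.\<close>
  have "card (V - A) = card (V - B)"
    using assms fin by (simp add: card_Diff_subset)
  then obtain h where h: "bij_betw h (V - A) (V - B)"
    using finite_same_card_bij[of "V - A" "V - B"] assms(1) by blast
  define \<sigma> where "\<sigma> = (\<lambda>x. if x \<in> A then g x else if x \<in> V then h x else x)"
  have 1: "bij_betw \<sigma> A B"
    using g by (rule bij_betw_cong[THEN iffD1, rotated]) (simp add: \<sigma>_def)
  have 2: "bij_betw \<sigma> (V - A) (V - B)"
    using h by (rule bij_betw_cong[THEN iffD1, rotated]) (simp add: \<sigma>_def)
  have "bij_betw \<sigma> (A \<union> (V - A)) (B \<union> (V - B))"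
    by (rule bij_betw_combine[OF 1 2]) auto
  then have "bij_betw \<sigma> V V"
    using assms by (simp add: Un_absorb1)
  then have "\<sigma> permutes V"
    by (rule bij_imp_permutes) (use assms(2) in \<open>auto simp: \<sigma>_def\<close>)
  then show ?thesis
    using 1 by (auto simp: bij_betw_def)
qed

text \<open>Composition with a permutation that carries \<open>v\<close> to \<open>w\<close> injects
  the permutations sending \<open>e\<close> to \<open>v\<close> into those sending \<open>e\<close>
  to \<open>w\<close>. So all these fibres have the same size, and together they partition the
  permutations of \<open>V\<close>: the image of \<open>e\<close> is uniformly distributed.\<close>

lemma card_permutes_image_eq:
  assumes V: "finite V" and e: "e \<subseteq> V" "card e = r" and u: "u \<subseteq> V" "card u = r"
  shows "card {\<pi>. \<pi> permutes V \<and> \<pi> ` e = u} * card {e. e \<subseteq> V \<and> card e = r} = fact (card V)"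
proof -
  let ?P = "{e. e \<subseteq> V \<and> card e = r}"
  let ?K = "\<lambda>u. {\<pi>. \<pi> permutes V \<and> \<pi> ` e = u}"
  have finP: "finite ?P"
    using V by simp
  have finK: "finite (?K w)" for w
    by (rule finite_subset[OF _ finite_permutations[OF V]]) auto
  have le: "card (?K v) \<le> card (?K w)" if vw: "v \<in> ?P" "w \<in> ?P" for v w
  proof -
    obtain \<sigma> where \<sigma>: "\<sigma> permutes V" "\<sigma> ` v = w"
      using ex_permutes_image_eq[OF V, of v w] vw by auto
    have "inj_on ((\<circ>) \<sigma>) (?K v)"
      using fun.inj_map[OF permutes_inj[OF \<sigma>(1)]] by (rule inj_on_subset) simp
    moreover have "(\<circ>) \<sigma> ` ?K v \<subseteq> ?K w"
      using \<sigma> by (auto intro: permutes_compose simp: image_comp[symmetric])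
    ultimately show ?thesis
      using finK by (rule card_inj_on_le)
  qed
  have eq: "card (?K w) = card (?K u)" if "w \<in> ?P" for w
    using le[of w u] le[of u w] that u by simp
  have "\<pi> ` e \<in> ?P" if "\<pi> permutes V" for \<pi>
    using image_mono[OF e(1), of \<pi>] permutes_image[OF that] e(2)
      card_image[OF permutes_inj_on[OF that]] by simp
  then have "{\<pi>. \<pi> permutes V} = (\<Union>w\<in>?P. ?K w)"
    by blast
  then have "fact (card V) = card (\<Union>w\<in>?P. ?K w)"
    using card_permutations[OF refl V] by simp
  also have "\<dots> = (\<Sum>w\<in>?P. card (?K w))"
    using finP finK by (intro card_UN_disjoint) auto
  also have "\<dots> = card (?K u) * card ?P"
    using eq by simp
  finally show ?thesis by simp
qed

text \<open>By uniformity, the mean of \<open>card ((\<close>) \<pi> \<open>E \<inter> U)\<close>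
  over all permutations is \<open>card E * card U\<close> divided by the number of
  \<open>r\<close>-subsets, and some permutation attains at least the mean. The denominator is
  multiplied out to stay in the naturals.\<close>

lemma ex_permutes_card_image_Int_ge:
  assumes V: "finite V"
    and E: "E \<subseteq> {e. e \<subseteq> V \<and> card e = r}" and U: "U \<subseteq> {e. e \<subseteq> V \<and> card e = r}"
  shows "\<exists>\<pi>. \<pi> permutes V \<and>
    card E * card U \<le> card {e. e \<subseteq> V \<and> card e = r} * card ((`) \<pi> ` E \<inter> U)"
proof (rule ccontr)
  let ?P = "{e. e \<subseteq> V \<and> card e = r}"
  let ?S = "{\<pi>. \<pi> permutes V}"
  assume "\<not> ?thesis"
  then have less: "card ?P * card ((`) \<pi> ` E \<inter> U) < card E * card U" if "\<pi> \<in> ?S" for \<pi>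
    using that by (auto simp: not_le)
  have finE: "finite E" and finU: "finite U"
    using V E U by (auto elim: finite_subset)
  have finS: "finite ?S" "?S \<noteq> {}" "card ?S = fact (card V)"
    using V finite_permutations card_permutations permutes_id by blast+
  have *: "card ((`) \<pi> ` E \<inter> U) = (\<Sum>e\<in>E. \<Sum>u\<in>U. if \<pi> ` e = u then 1 else 0)"
    if "\<pi> \<in> ?S" for \<pi>
  proof -
    \<comment> \<open>Since \<pi> acts injectively on sets, the image edges in \<open>U\<close> can
      be counted by their preimages in \<open>E\<close>; this gives a sum of indicators whose order
      of summation can be exchanged.\<close>
    have "inj ((`) \<pi>)"
      using permutes_inj[of \<pi> V] that by (intro injI) (simp add: inj_image_eq_iff)
    then have "card {e\<in>E. \<pi> ` e \<in> U} = card ((`) \<pi> ` {e\<in>E. \<pi> ` e \<in> U})"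
      by (rule card_image[OF inj_on_subset[OF _ subset_UNIV], symmetric])
    also have "(`) \<pi> ` {e\<in>E. \<pi> ` e \<in> U} = (`) \<pi> ` E \<inter> U"
      by auto
    finally show ?thesis
      using finE finU by (simp add: sum.If_cases Int_def)
  qed
  have K: "(\<Sum>\<pi>\<in>?S. if \<pi> ` e = u then 1 else 0) = card {\<pi>. \<pi> permutes V \<and> \<pi> ` e = u}" for e u
    using finS by (simp add: sum.If_cases Int_def)
  have "(\<Sum>\<pi>\<in>?S. card ((`) \<pi> ` E \<inter> U)) =
      (\<Sum>\<pi>\<in>?S. \<Sum>e\<in>E. \<Sum>u\<in>U. if \<pi> ` e = u then 1 else 0)"
    using * by (rule sum.cong[OF refl])
  also have "\<dots> = (\<Sum>e\<in>E. \<Sum>u\<in>U. \<Sum>\<pi>\<in>?S. if \<pi> ` e = u then 1 else 0)"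
    by (subst sum.swap, rule sum.cong[OF refl], rule sum.swap)
  also have "\<dots> = (\<Sum>e\<in>E. \<Sum>u\<in>U. card {\<pi>. \<pi> permutes V \<and> \<pi> ` e = u})"
    by (simp only: K)
  finally have "(\<Sum>\<pi>\<in>?S. card ?P * card ((`) \<pi> ` E \<inter> U)) =
      (\<Sum>e\<in>E. \<Sum>u\<in>U. card {\<pi>. \<pi> permutes V \<and> \<pi> ` e = u} * card ?P)"
    by (simp only: sum_distrib_left[symmetric] sum_distrib_right[symmetric] mult.commute)
  also have "\<dots> = (\<Sum>e\<in>E. \<Sum>u\<in>U. fact (card V))"
    using E U by (intro sum.cong refl card_permutes_image_eq[OF V]) auto
  also have "\<dots> = (\<Sum>\<pi>\<in>?S. card E * card U)"
    using finS by simp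
  finally have "(\<Sum>\<pi>\<in>?S. card ?P * card ((`) \<pi> ` E \<inter> U)) = (\<Sum>\<pi>\<in>?S. card E * card U)" .
  moreover have "(\<Sum>\<pi>\<in>?S. card ?P * card ((`) \<pi> ` E \<inter> U)) < (\<Sum>\<pi>\<in>?S. card E * card U)"
    using finS less by (intro sum_strict_mono) auto
  ultimately show False by simp
qed

section \<open>Walks, girth and distance\<close>

lemma walk_iff_successively:
  "walk G p \<longleftrightarrow> p \<noteq> [] \<and> set p \<subseteq> verts G \<and> successively (\<lambda>x y. {x, y} \<in> edges G) p"
  by (auto simp: walk_def successively_conv_nth)

lemma walk_mono:
  assumes "walk H p" "verts H \<subseteq> verts G" "edges H \<subseteq> edges G"
  shows "walk G p"
  using assms by (auto simp: walk_def)

lemma walk_map: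
  assumes "walk H p" "\<phi> ` verts H \<subseteq> verts G" "(`) \<phi> ` edges H \<subseteq> edges G"
  shows "walk G (map \<phi> p)"
proof -
  have "{\<phi> (p ! i), \<phi> (p ! Suc i)} \<in> edges G" if "Suc i < length p" for i
  proof -
    have "{p ! i, p ! Suc i} \<in> edges H"
      using assms(1) that by (simp add: walk_def)
    from imageI[OF this, of "(`) \<phi>"] show ?thesis
      using assms(3) by auto
  qed
  moreover have "\<phi> ` set p \<subseteq> verts G"
    using assms(1,2) by (blast dest: walk_def[THEN iffD1])
  ultimately show ?thesis
    using assms(1) by (simp add: walk_def)
qed

text \<open>An injective homomorphism carries each cycle of \<open>H\<close> to a cycle of
  \<open>G\<close> of the same length.\<close>

lemma girth_le_of_inj_on:
  assumes inj: "inj_on \<phi> (verts H)"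
    and "\<phi> ` verts H \<subseteq> verts G" "(`) \<phi> ` edges H \<subseteq> edges G"
  shows "girth G \<le> girth H"
  unfolding girth_def
proof (rule INF_greatest)
  fix p assume "p \<in> {p. cycle H p}"
  then have p: "walk H p" "length p \<ge> 3" "distinct p" "{last p, hd p} \<in> edges H"
    by (auto simp: cycle_def)
  have ne: "p \<noteq> []"
    using p by auto
  have "{\<phi> (last p), \<phi> (hd p)} \<in> edges G"
    using imageI[OF p(4), of "(`) \<phi>"] assms(3) by auto
  moreover have "distinct (map \<phi> p)"
    using p inj by (auto simp: distinct_map walk_def elim: inj_on_subset)
  ultimately have "cycle G (map \<phi> p)"
    using p ne walk_map[OF p(1) assms(2,3)] by (simp add: cycle_def last_map hd_map)
  then show "(INF p\<in>{p. cycle G p}. enat (length p)) \<le> enat (length p)"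
    by (intro INF_lower2[of "map \<phi> p"]) auto
qed

text \<open>Without any walk the infimum would be infinite. A shortest walk repeats no vertex, since
  the closed stretch between two occurrences could be cut out. The bound is \<open>Suc t\<close>
  because \<open>length\<close> counts vertices, not edges.\<close>

lemma ex_distinct_walk_of_gdist_le:
  assumes "gdist G u v \<le> enat t"
  shows "\<exists>p. walk G p \<and> distinct p \<and> hd p = u \<and> last p = v \<and> length p \<le> Suc t"
proof -
  let ?W = "{p. walk G p \<and> hd p = u \<and> last p = v}"
  have "?W \<noteq> {}"
  proof
    assume "?W = {}"
    then have "gdist G u v = \<infinity>"
      unfolding gdist_def by (simp only: image_empty Inf_empty top_enat_def)
    then show False
      using assms by simp
  qed
  then obtain p where p: "p \<in> ?W" and min: "\<And>q. q \<in> ?W \<Longrightarrow> length p \<le> length q"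
    using ex_has_least_nat[of "\<lambda>p. p \<in> ?W" _ length] by blast
  have "enat (length p - 1) \<le> gdist G u v"
    unfolding gdist_def by (rule INF_greatest) (use min diff_le_mono in auto)
  then have "enat (length p - 1) \<le> enat t"
    using assms by (rule order_trans)
  then have "length p \<le> Suc t"
    by simp
  moreover have "distinct p"
  proof (rule ccontr)
    assume "\<not> distinct p"
    then obtain xs ys zs y where d: "p = xs @ [y] @ ys @ [y] @ zs"
      using not_distinct_decomp by blast
    have "xs @ [y] @ zs \<in> ?W"
      using p unfolding d
      by (cases xs) (auto simp: walk_iff_successively successively_append_iff successively_Cons
          hd_append split: if_splits)
    then show False
      using min[of "xs @ [y] @ zs"] d by simp
  qed
  ultimately show ?thesis
    using p by auto
qed

section \<open>Edges as two-element subsets\<close>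

lemma simple_graph_edges_subset:
  "simple_graph G \<Longrightarrow> edges G \<subseteq> {e. e \<subseteq> verts G \<and> card e = 2}"
  by (force simp: simple_graph_def)

lemma simple_graph_iff:
  "simple_graph G \<longleftrightarrow> finite (verts G) \<and> edges G \<subseteq> {e. e \<subseteq> verts G \<and> card e = 2}"
  by (fastforce simp: simple_graph_def card_2_iff)

lemma finite_edges: "simple_graph G \<Longrightarrow> finite (edges G)"
  by (rule finite_subset[OF simple_graph_edges_subset]) (auto simp: simple_graph_def)

section \<open>Colour classes of large girth and their spanners\<close>

definition color_class :: "'a graph \<Rightarrow> ('a set \<Rightarrow> 'c) \<Rightarrow> 'c \<Rightarrow> 'a graph" where
  "color_class G col j = (verts G, {e \<in> edges G. col e = j})"

text \<open>A walk that replaces a missing edge \<open>e\<close> has at most \<open>2 * k\<close>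
  vertices and closes up with \<open>e\<close> to a cycle inside one colour class, contradicting the
  girth bound.\<close>

lemma ecft_spanner_edges_eq:
  fixes G :: "'a graph" and col :: "'a set \<Rightarrow> nat"
  assumes G: "simple_graph G" and k: "k \<ge> 1"
    and col: "\<And>e. e \<in> edges G \<Longrightarrow> col e < f"
    and girth: "\<And>j. girth (color_class G col j) \<ge> enat (2 * k + 2)"
    and H: "ecft_spanner f (2 * k - 1) G col H"
  shows "edges H = edges G"
proof
  have sub: "verts H \<subseteq> verts G" "edges H \<subseteq> edges G"
    using H by (auto simp: ecft_spanner_def subgraph_def)
  show "edges H \<subseteq> edges G"
    by (fact sub)
  show "edges G \<subseteq> edges H"
  proof (rule subsetI, rule ccontr)
    fix e assume e: "e \<in> edges G" and notin: "e \<notin> edges H"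
    obtain u v where uv: "u \<in> verts G" "v \<in> verts G" "u \<noteq> v" "e = {u, v}"
      using G e by (auto simp: simple_graph_def)
    \<comment> \<open>All edge colours lie below \<open>f\<close>, so only the colour of
      \<open>e\<close> survives this failure.\<close>
    let ?F = "{..<f} - {col e}"
    let ?H = "del_colors H col ?F"
    have "card ?F \<le> f"
      using card_Diff1_le[of "{..<f}" "col e"] by simp
    then have le: "gdist ?H u v \<le> enat (2 * k - 1) * gdist (del_colors G col ?F) u v"
      using H uv by (auto simp: ecft_spanner_def)
    have "walk (del_colors G col ?F) [u, v]"
      using uv e by (auto simp: walk_def del_colors_def)
    then have "gdist (del_colors G col ?F) u v \<le> 1"
      unfolding gdist_def by (intro INF_lower2[of "[u, v]"]) (auto simp: one_enat_def)
    then have "gdist ?H u v \<le> enat (2 * k - 1)"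
      using le mult_left_mono[of "gdist (del_colors G col ?F) u v" 1 "enat (2 * k - 1)"] by force
    then obtain p where p: "walk ?H p" "distinct p" "hd p = u" "last p = v" "length p \<le> Suc (2 * k - 1)"
      by (blast dest: ex_distinct_walk_of_gdist_le)
    \<comment> \<open>One vertex is impossible as \<open>u \<noteq> v\<close>; with two vertices the
      walk would be \<open>e\<close> itself, which \<open>H\<close> lacks.\<close>
    have len: "length p \<ge> 3"
    proof (rule ccontr)
      assume "\<not> length p \<ge> 3"
      moreover have "p \<noteq> []"
        using p(1) by (simp add: walk_def)
      ultimately consider a where "p = [a]" | a b where "p = [a, b]"
        by (cases p rule: remdups_adj.cases) (auto simp: Suc_le_eq numeral_3_eq_3)
      then show False
        using p uv notin by cases (auto simp: walk_def del_colors_def)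
    qed
    have "walk (color_class G col (col e)) p"
      using p(1) by (rule walk_mono) (use sub col in \<open>auto simp: del_colors_def color_class_def\<close>)
    then have "cycle (color_class G col (col e)) p"
      using p len uv e by (simp add: cycle_def color_class_def insert_commute)
    then have "girth (color_class G col (col e)) \<le> enat (length p)"
      unfolding girth_def by (intro INF_lower) simp
    then have "enat (2 * k + 2) \<le> enat (length p)"
      by (rule order_trans[OF girth])
    then show False
      using p(5) by simp
  qed
qed

section \<open>Greedy overlay of relabelled copies\<close>

lemma ex_graph_color_classes_girth:
  fixes G0 :: "'a graph" and f :: nat
  assumes G0: "simple_graph G0" "card (verts G0) \<ge> 2"
  shows "\<exists>(G :: 'a graph) (col :: 'a set \<Rightarrow> nat). simple_graph G \<and> verts G = verts G0 \<and>
    (\<forall>e\<in>edges G. col e < f) \<and> (\<forall>j. girth G0 \<le> girth (color_class G col j)) \<and>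
    real (card (edges G)) \<ge>
      min (real f * real (card (edges G0))) (real (card (verts G0) choose 2)) / 2"
\<comment> \<open>Each step adds one copy. Colours below \<open>f\<close> leave \<open>f\<close> as
  a fresh colour, and the minimum in the bound allows the process to stop once half of all pairs are
  covered.\<close>
proof (induction f)
  case 0
  have "girth G0 \<le> girth (verts G0, {})"
    by (rule girth_le_of_inj_on[of id]) auto
  then show ?case
    using G0 by (intro exI[of _ "(verts G0, {})"]) (auto simp: simple_graph_def color_class_def)
next
  case (Suc f)
  let ?V = "verts G0" and ?m = "real (card (edges G0))"
  let ?P = "{e. e \<subseteq> ?V \<and> card e = 2}"
  let ?N = "card ?P"
  have V: "finite ?V"
    using G0 by (simp add: simple_graph_def)
  have N: "?N = card ?V choose 2"
    using n_subsets[OF V] by simp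
  have Npos: "0 < ?N"
    using G0 by (simp add: N zero_less_binomial_iff)
  obtain G :: "'a graph" and col :: "'a set \<Rightarrow> nat" where G: "simple_graph G" "verts G = ?V"
    and col: "\<And>e. e \<in> edges G \<Longrightarrow> col e < f"
    and girth: "\<And>j. girth G0 \<le> girth (color_class G col j)"
    and card: "real (card (edges G)) \<ge> min (real f * ?m) (real ?N) / 2"
    using Suc.IH unfolding N by blast
  show ?case
  proof (cases "real (card (edges G)) \<ge> real ?N / 2")
    \<comment> \<open>The graph is already saturated and is kept as it is.\<close>
    case True
    then have "real (card (edges G)) \<ge> min (real (Suc f) * ?m) (real ?N) / 2"
      by linarith
    then show ?thesis
      using G col girth unfolding N by (intro exI[of _ G] exI[of _ col]) (auto intro: less_SucI)
  next
    case False
    let ?U = "?P - edges G"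
    have EG: "edges G \<subseteq> ?P"
      using simple_graph_edges_subset[OF G(1)] by (simp add: G(2))
    have U: "real (card ?U) \<ge> real ?N / 2"
      using False EG finite_edges[OF G(1)] V
      by (simp add: card_Diff_subset card_mono of_nat_diff)
    \<comment> \<open>At least half of all pairs are still free, so the averaging bound yields a
      copy with at least half of its edges new. This is the source of the factor 1/2.\<close>
    obtain \<pi> where \<pi>: "\<pi> permutes ?V"
      and big: "card (edges G0) * card ?U \<le> ?N * card ((`) \<pi> ` edges G0 \<inter> ?U)"
      using ex_permutes_card_image_Int_ge[OF V simple_graph_edges_subset[OF G0(1)], of ?U] by auto
    have "?m * (real ?N / 2) \<le> ?m * real (card ?U)"
      using U by (intro mult_left_mono) auto
    also have "\<dots> \<le> real ?N * real (card ((`) \<pi> ` edges G0 \<inter> ?U))"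
      using big unfolding of_nat_mult[symmetric] of_nat_le_iff .
    finally have new: "?m / 2 \<le> real (card ((`) \<pi> ` edges G0 \<inter> ?U))"
      using Npos by (simp add: field_simps)
    define G' where "G' = (?V, edges G \<union> (`) \<pi> ` edges G0)"
    \<comment> \<open>Edges shared with \<open>G\<close> keep their colour, so the old classes do
      not change and class \<open>f\<close> lies inside the new copy.\<close>
    define col' where "col' = (\<lambda>e. if e \<in> edges G then col e else f)"
    have img: "(`) \<pi> ` edges G0 \<subseteq> ?P"
      using simple_graph_edges_subset[OF G0(1)] permutes_in_image[OF \<pi>]
      by (auto simp: card_image[OF permutes_inj_on[OF \<pi>]])
    have "simple_graph G'"
      using V EG img by (simp add: simple_graph_iff G'_def)
    moreover have "col' e < Suc f" if "e \<in> edges G'" for e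
      using col by (auto simp: col'_def intro: less_SucI)
    moreover have "girth G0 \<le> girth (color_class G' col' j)" for j
    proof (cases "j = f")
      case True
      have "{e \<in> edges G'. col' e = f} \<subseteq> (`) \<pi> ` edges G0"
        using col by (auto simp: G'_def col'_def)
      \<comment> \<open>Undoing the relabelling embeds the new class into \<open>G0\<close>, whose
        girth therefore bounds that of the class from below.\<close>
      then have "(`) (inv \<pi>) ` {e \<in> edges G'. col' e = f} \<subseteq> edges G0"
        using permutes_inj[OF \<pi>] by (auto simp: image_comp)
      then show ?thesis
        using True permutes_image[OF permutes_inv[OF \<pi>]] permutes_inj_on[OF permutes_inv[OF \<pi>]]
        by (intro girth_le_of_inj_on[of "inv \<pi>"]) (auto simp: color_class_def G'_def)
    next
      case False
      then have "color_class G' col' j = color_class G col j"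
        by (auto simp: color_class_def G'_def col'_def G(2))
      then show ?thesis
        using girth by simp
    qed
    moreover have "real (card (edges G')) \<ge> min (real (Suc f) * ?m) (real ?N) / 2"
    proof -
      have "edges G' = edges G \<union> ((`) \<pi> ` edges G0 \<inter> ?U)"
        using img by (auto simp: G'_def)
      moreover have "card (edges G \<union> ((`) \<pi> ` edges G0 \<inter> ?U)) =
          card (edges G) + card ((`) \<pi> ` edges G0 \<inter> ?U)"
        using finite_edges[OF G(1)] finite_edges[OF G0(1)] by (intro card_Un_disjoint) auto
      ultimately have "card (edges G') = card (edges G) + card ((`) \<pi> ` edges G0 \<inter> ?U)"
        by simp
      then show ?thesis
        using card new by (simp add: min_def field_simps split: if_splits)
    qed
    ultimately show ?thesis
      unfolding N by (intro exI[of _ G'] exI[of _ col']) (auto simp: G'_def)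
  qed
qed

section \<open>The edge bound and its constants\<close>

lemma ecft_spanner_lower_bound:
  assumes c: "girth_bound c k" "c > 0" and "n \<ge> 2" "k \<ge> 1"
  shows "\<exists>(G :: nat graph) (col :: nat set \<Rightarrow> nat). simple_graph G \<and> card (verts G) = n \<and>
    (\<forall>H. ecft_spanner f (2 * k - 1) G col H \<longrightarrow>
      real (card (edges H)) \<ge>
        min (c / 2) (1 / 8) * min (real f * real n powr (1 + 1 / real k)) (real n ^ 2))"
proof -
  let ?x = "real n powr (1 + 1 / real k)"
  obtain G0 :: "nat graph" where G0: "simple_graph G0" "card (verts G0) = n"
    and girth0: "girth G0 \<ge> enat (2 * k + 2)" and m: "real (card (edges G0)) \<ge> c * ?x"
    using assms by (auto simp: girth_bound_def)
  obtain G :: "nat graph" and col :: "nat set \<Rightarrow> nat"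
    where G: "simple_graph G" "verts G = verts G0"
    and col: "\<And>e. e \<in> edges G \<Longrightarrow> col e < f"
    and girth: "\<And>j. girth G0 \<le> girth (color_class G col j)"
    and card: "real (card (edges G)) \<ge>
      min (real f * real (card (edges G0))) (real (n choose 2)) / 2"
    using ex_graph_color_classes_girth[of G0 f] G0 assms(3) by blast
  \<comment> \<open>The factor \<open>c / 2\<close> is the girth constant times the overlay loss.
    The factor 1/8 comes from \<open>n choose 2\<close>: half of it is n(n-1)/4, which is at least
    n^2/8 as n - 1 \<ge> n/2 for n \<ge> 2.\<close>
  let ?d = "min (c / 2) (1 / 8)" and ?M = "min (real f * ?x) (real n ^ 2)"
  have M: "0 \<le> ?M"
    by simp
  have "?d * ?M \<le> c / 2 * (real f * ?x)"
    using M c by (intro mult_mono) auto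
  also have "\<dots> \<le> real f * real (card (edges G0)) / 2"
    using mult_left_mono[OF m, of "real f"] by (simp add: field_simps)
  finally have 1: "?d * ?M \<le> real f * real (card (edges G0)) / 2" .
  have "?d * ?M \<le> 1 / 8 * real n ^ 2"
    using M c by (intro mult_mono) auto
  also have "\<dots> \<le> real n * (real n - 1) / 4"
  proof -
    have "real n * 2 \<le> real n * real n"
      using assms(3) by (intro mult_left_mono) auto
    then show ?thesis
      by (simp add: power2_eq_square right_diff_distrib)
  qed
  also have "\<dots> = real (n choose 2) / 2"
    using assms(3) by (simp add: choose_two real_of_nat_div of_nat_diff)
  finally have 2: "?d * ?M \<le> real (n choose 2) / 2" .
  \<comment> \<open>Every spanner contains all edges of \<open>G\<close>, so the bound for
    \<open>G\<close> passes to it.\<close>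
  have "real (card (edges H)) \<ge> ?d * ?M" if "ecft_spanner f (2 * k - 1) G col H" for H
    using ecft_spanner_edges_eq[OF G(1) assms(4) col order_trans[OF girth0 girth] that] 1 2 card
    by simp
  then show ?thesis
    using G G0(2) by (intro exI[of _ G] exI[of _ col]) auto
qed

theorem theorem4p2:
  shows
    "(erdos_girth_conjecture \<longrightarrow>
       (\<exists>c::real. c > 0 \<and> (\<forall>(n::nat) (k::nat) (f::nat). n \<ge> 2 \<and> k \<ge> 1 \<and> f \<ge> 1 \<longrightarrow>
         (\<exists>(G :: nat graph) (col :: nat set \<Rightarrow> nat). simple_graph G \<and> card (verts G) = n \<and>
           (\<forall>H. ecft_spanner f (2 * k - 1) G col H \<longrightarrow>
             real (card (edges H)) \<ge>
               c * min (real f * real n powr (1 + 1 / real k)) (real n ^ 2)))))) \<and>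
     (erdos_girth_conjecture_fixed_k \<longrightarrow>
       (\<forall>k::nat. k \<ge> 1 \<longrightarrow> (\<exists>c::real. c > 0 \<and> (\<forall>(n::nat) (f::nat). n \<ge> 2 \<and> f \<ge> 1 \<longrightarrow>
         (\<exists>(G :: nat graph) (col :: nat set \<Rightarrow> nat). simple_graph G \<and> card (verts G) = n \<and>
           (\<forall>H. ecft_spanner f (2 * k - 1) G col H \<longrightarrow>
             real (card (edges H)) \<ge>
               c * min (real f * real n powr (1 + 1 / real k)) (real n ^ 2)))))))"
proof (intro conjI impI allI)
  assume erdos_girth_conjecture
  then obtain c where c: "c > 0" "\<And>k. k \<ge> 1 \<Longrightarrow> girth_bound c k"
    by (auto simp: erdos_girth_conjecture_def)
  show "\<exists>c::real. c > 0 \<and> (\<forall>(n::nat) (k::nat) (f::nat). n \<ge> 2 \<and> k \<ge> 1 \<and> f \<ge> 1 \<longrightarrow>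
      (\<exists>(G :: nat graph) (col :: nat set \<Rightarrow> nat). simple_graph G \<and> card (verts G) = n \<and>
        (\<forall>H. ecft_spanner f (2 * k - 1) G col H \<longrightarrow>
          real (card (edges H)) \<ge>
            c * min (real f * real n powr (1 + 1 / real k)) (real n ^ 2))))"
    \<comment> \<open>The witness depends on \<open>c\<close> alone, so an absolute constant in the
      conjecture gives one that is uniform in \<open>k\<close>.\<close>
    using c by (intro exI[of _ "min (c / 2) (1 / 8)"] conjI allI impI ecft_spanner_lower_bound) auto
next
  fix k :: nat
  assume erdos_girth_conjecture_fixed_k and k: "k \<ge> 1"
  then obtain c where c: "c > 0" "girth_bound c k"
    by (auto simp: erdos_girth_conjecture_fixed_k_def)
  show "\<exists>c::real. c > 0 \<and> (\<forall>(n::nat) (f::nat). n \<ge> 2 \<and> f \<ge> 1 \<longrightarrow>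
      (\<exists>(G :: nat graph) (col :: nat set \<Rightarrow> nat). simple_graph G \<and> card (verts G) = n \<and>
        (\<forall>H. ecft_spanner f (2 * k - 1) G col H \<longrightarrow>
          real (card (edges H)) \<ge>
            c * min (real f * real n powr (1 + 1 / real k)) (real n ^ 2))))"
    using c k by (intro exI[of _ "min (c / 2) (1 / 8)"] conjI allI impI ecft_spanner_lower_bound) auto
qed

end
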